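(* Let $n\ge 3$ and $D_n=\langle a,b\mid a^n=b^2=1,\ ab=ba^{-1}\rangle$. Then $\Gamma_N(D_n)$ has no edges (is totally disconnected) if and only if $n$ is an odd prime.
   Context: $\Gamma_N(G)$ denotes the simple graph whose vertices are the proper non-normal subgroups of the group $G$, two distinct vertices $H,K$ being adjacent iff $HK=KH$. *)

theory Defs
  imports "HOL-Algebra.Coset" "HOL-Computational_Algebra.Primes"
begin

text \<open>Group presentations. A letter \<open>(x, True)\<close> is the generator \<open>x\<close> and \<open>(x, False)\<close> is its formal
  inverse; every element of the type \<open>'g\<close> is a generator. A pair \<open>(l, r)\<close> of words is the
  relation \<open>l = r\<close>.\<close>

type_synonym 'g word = "('g \<times> bool) list"

text \<open>The least congruence on words that cancels adjacent inverse letters and contains the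
  relations.\<close>

inductive pres_eq :: "('g word \<times> 'g word) set \<Rightarrow> 'g word \<Rightarrow> 'g word \<Rightarrow> bool"
  for R :: "('g word \<times> 'g word) set" where
  refl: "pres_eq R u u"
| sym: "pres_eq R u v \<Longrightarrow> pres_eq R v u"
| trans: "pres_eq R u v \<Longrightarrow> pres_eq R v w \<Longrightarrow> pres_eq R u w"
| cancel: "pres_eq R (u @ [(x, e), (x, \<not> e)] @ v) (u @ v)"
| rel: "(l, r) \<in> R \<Longrightarrow> pres_eq R (u @ l @ v) (u @ r @ v)"

definition presented_group :: "('g word \<times> 'g word) set \<Rightarrow> 'g word set monoid" where
  "presented_group R =
    \<lparr>carrier = UNIV // {(u, v). pres_eq R u v},
     monoid.mult = (\<lambda>A B. {w. \<exists>u\<in>A. \<exists>v\<in>B. pres_eq R (u @ v) w}),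
     one = {w. pres_eq R [] w}\<rparr>"

datatype dihedral_gen = Gen_a | Gen_b

definition dihedral_relations :: "nat \<Rightarrow> (dihedral_gen word \<times> dihedral_gen word) set" where
  "dihedral_relations n =
    (let a = (Gen_a, True); a_inv = (Gen_a, False); b = (Gen_b, True)
     in {(replicate n a, []), (replicate 2 b, []), ([a, b], [b, a_inv])})"

definition dihedral_group :: "nat \<Rightarrow> dihedral_gen word set monoid" where
  "dihedral_group n = presented_group (dihedral_relations n)"

text \<open>A simple graph is given by its vertex set and its set of edges, the latter being two-element
  sets of vertices.\<close>

definition Gamma_N_verts :: "('a, 'm) monoid_scheme \<Rightarrow> 'a set set" where
  "Gamma_N_verts G = {H. subgroup H G \<and> H \<noteq> carrier G \<and> \<not> H \<lhd> G}"

definition Gamma_N_edges :: "('a, 'm) monoid_scheme \<Rightarrow> 'a set set set" where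
  "Gamma_N_edges G =
    {{H, K} | H K. H \<in> Gamma_N_verts G \<and> K \<in> Gamma_N_verts G \<and> H \<noteq> K \<and>
                   H <#>\<^bsub>G\<^esub> K = K <#>\<^bsub>G\<^esub> H}"

definition Gamma_N :: "('a, 'm) monoid_scheme \<Rightarrow> 'a set set \<times> 'a set set set" where
  "Gamma_N G = (Gamma_N_verts G, Gamma_N_edges G)"

definition totally_disconnected :: "'v set \<times> 'v set set \<Rightarrow> bool" where
  "totally_disconnected \<G> \<longleftrightarrow> snd \<G> = {}"

lemma pres_eq_append_left: "pres_eq R u v \<Longrightarrow> pres_eq R (w @ u) (w @ v)"
proof (induction rule: pres_eq.induct)
  case (cancel u x e v)
  show ?case using pres_eq.cancel[of R "w @ u" x e v] by simp
next
  case (rel l r u v)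
  then show ?case using pres_eq.rel[of l r R "w @ u" v] by simp
qed (blast intro: pres_eq.intros)+

lemma pres_eq_append_right: "pres_eq R u v \<Longrightarrow> pres_eq R (u @ w) (v @ w)"
proof (induction rule: pres_eq.induct)
  case (cancel u x e v)
  show ?case using pres_eq.cancel[of R u x e "v @ w"] by simp
next
  case (rel l r u v)
  then show ?case using pres_eq.rel[of l r R u "v @ w"] by simp
qed (blast intro: pres_eq.intros)+

lemma pres_eq_append: "pres_eq R u u' \<Longrightarrow> pres_eq R v v' \<Longrightarrow> pres_eq R (u @ v) (u' @ v')"
  by (meson pres_eq_append_left pres_eq_append_right pres_eq.trans)

abbreviation pres_class :: "('g word \<times> 'g word) set \<Rightarrow> 'g word \<Rightarrow> 'g word set" where
  "pres_class R u \<equiv> {w. pres_eq R u w}"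

lemma carrier_presented_group: "carrier (presented_group R) = range (pres_class R)"
  by (auto simp: presented_group_def quotient_def)

lemma one_presented_group: "\<one>\<^bsub>presented_group R\<^esub> = pres_class R []"
  by (simp add: presented_group_def)

lemma mult_presented_group:
  "pres_class R u \<otimes>\<^bsub>presented_group R\<^esub> pres_class R v = pres_class R (u @ v)"
  by (auto simp: presented_group_def)
     (meson pres_eq.refl pres_eq.trans pres_eq_append)+

lemma pres_eq_inverse: "pres_eq R (rev (map (\<lambda>(x, e). (x, \<not> e)) u) @ u) []"
proof (induction u)
  case Nil
  show ?case by (simp add: pres_eq.refl)
next
  case (Cons p u)
  obtain x e where p: "p = (x, e)" by (cases p)
  let ?i = "rev (map (\<lambda>(x, e). (x, \<not> e)) u)"
  have "pres_eq R (?i @ [(x, \<not> e), (x, \<not> \<not> e)] @ u) (?i @ u)"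
    by (rule pres_eq.cancel)
  then show ?case using Cons.IH by (simp add: p) (blast intro: pres_eq.trans)
qed

lemma group_presented_group: "group (presented_group R)"
proof (rule groupI)
  fix A assume "A \<in> carrier (presented_group R)"
  then obtain u where u: "A = pres_class R u" by (auto simp: carrier_presented_group)
  have "pres_class R (rev (map (\<lambda>(x, e). (x, \<not> e)) u) @ u) = pres_class R []"
    using pres_eq_inverse[of R u] by (auto intro: pres_eq.trans pres_eq.sym)
  then show "\<exists>B\<in>carrier (presented_group R). B \<otimes>\<^bsub>presented_group R\<^esub> A = \<one>\<^bsub>presented_group R\<^esub>"
    by (auto simp: carrier_presented_group one_presented_group mult_presented_group u)
qed (auto simp: carrier_presented_group one_presented_group mult_presented_group)

end

theory Submission
  imports Defs "HOL-Number_Theory.Cong"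
begin

text \<open>
  The elements of \<open>D\<^sub>n\<close> are \<open>a\<^sup>i b\<^sup>e\<close> with \<open>i\<close> modulo \<open>n\<close> and \<open>e \<in> {0, 1}\<close>; they are told apart by the
  action \<open>a \<cdot> t = t + 1\<close>, \<open>b \<cdot> t = - t\<close> on the integers modulo \<open>n\<close>.
  If \<open>n\<close> is an odd prime, a subgroup containing a non-trivial rotation contains all of them, so the
  non-normal proper subgroups are those generated by one reflection; two distinct reflections do not
  commute because \<open>n\<close> is odd. If \<open>n\<close> is even, \<open>\<langle>b\<rangle>\<close> and \<open>\<langle>a\<^bsup>n/2\<^esup> b\<rangle>\<close> are adjacent. If \<open>n\<close> is odd with a
  proper divisor \<open>d > 1\<close>, then \<open>\<langle>b\<rangle>\<close> is adjacent to the larger subgroup \<open>\<langle>a\<^sup>d, b\<rangle>\<close>.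
\<close>

section \<open>Coordinates and reflection subgroups\<close>

text \<open>The element \<open>x i e\<close> stands for \<open>a\<^sup>i b\<^sup>e\<close>, so \<open>True\<close> marks the reflections.\<close>

locale dihedral = group G for G (structure) +
  fixes n :: nat and x :: "int \<Rightarrow> bool \<Rightarrow> 'a"
  assumes n_ge_3: "n \<ge> 3"
    and carrier_eq: "carrier G = {x i e | i e. True}"
    and mult: "x i e \<otimes> x j f = x (i + (if e then - j else j)) (e \<noteq> f)"
    and x_eq_iff: "x i e = x j f \<longleftrightarrow> [i = j] (mod int n) \<and> e = f"
begin

lemma x_closed [simp]: "x i e \<in> carrier G"
  by (auto simp: carrier_eq)

lemma one_eq: "\<one> = x 0 False"
  \<comment> \<open>An idempotent of a group is its identity.\<close>
  using r_cancel_one[of "x 0 False" "x 0 False"] by (simp add: mult)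

lemma inv_x: "inv (x i e) = x (if e then i else - i) e"
  by (rule inv_equality) (auto simp: mult one_eq)

lemma subgroup_mult:
  "subgroup H G \<Longrightarrow> x i e \<in> H \<Longrightarrow> x j f \<in> H \<Longrightarrow> x (i + (if e then - j else j)) (e \<noteq> f) \<in> H"
  using subgroup.m_closed[of H G "x i e" "x j f"] by (simp add: mult)

lemma normal_iff:
  assumes "subgroup H G"
  shows "H \<lhd> G \<longleftrightarrow> (\<forall>i e j f. x j f \<in> H \<longrightarrow> x i e \<otimes> x j f \<otimes> inv (x i e) \<in> H)"
proof -
  have "h \<in> carrier G" if "h \<in> H" for h
    using assms that by (rule subgroup.mem_carrier)
  then show ?thesis
    using assms by (fastforce simp: normal_inv_iff carrier_eq)
qed

definition refl_subgroup :: "int \<Rightarrow> 'a set" where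
  "refl_subgroup i = {x 0 False, x i True}"

lemma subgroup_refl_subgroup: "subgroup (refl_subgroup i) G"
  by (rule subgroupI) (auto simp: refl_subgroup_def mult inv_x)

lemma refl_subgroup_eq_iff: "refl_subgroup i = refl_subgroup j \<longleftrightarrow> [i = j] (mod int n)"
  by (auto simp: refl_subgroup_def x_eq_iff doubleton_eq_iff)

text \<open>Conjugating the reflection \<open>x i True\<close> by the rotation \<open>a\<close> gives \<open>x (i + 2) True\<close>.\<close>

lemma normal_shift:
  assumes "H \<lhd> G" "x i True \<in> H"
  shows "x (i + 2) True \<in> H"
  using normal.inv_op_closed2[OF assms(1), of "x 1 False" "x i True"] assms(2)
  by (simp add: mult inv_x add.commute)

text \<open>Since n is at least 3 it cannot divide 2, so conjugation by a moves every reflection;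
  this makes the reflection subgroups non-normal.\<close>

lemma not_cong_add_2: "\<not> [i + 2 = i] (mod int n)"
proof
  assume "[i + 2 = i] (mod int n)"
  then have "int n dvd 2"
    by (simp add: cong_iff_dvd_diff)
  then show False
    using n_ge_3 zdvd_imp_le by fastforce
qed

lemma refl_subgroup_vertex: "refl_subgroup i \<in> Gamma_N_verts G"
proof -
  have "\<not> refl_subgroup i \<lhd> G"
    using normal_shift[of "refl_subgroup i" i] not_cong_add_2[of i]
    by (auto simp: refl_subgroup_def x_eq_iff)
  \<comment> \<open>The same conjugate witnesses properness.\<close>
  moreover have "x (i + 2) True \<in> carrier G - refl_subgroup i"
    using not_cong_add_2[of i] by (auto simp: refl_subgroup_def x_eq_iff)
  ultimately show ?thesis
    using subgroup_refl_subgroup by (auto simp: Gamma_N_verts_def)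
qed

section \<open>Edges for even and for composite odd n\<close>

lemma edge_if_even:
  assumes "even n"
  shows "Gamma_N_edges G \<noteq> {}"
proof -
  obtain m where m: "n = 2 * m"
    using assms by blast
  let ?i = "int m"
  have "\<not> [0 = ?i] (mod int n)"
    using m n_ge_3 by (auto simp: cong_def)
  then have ne: "refl_subgroup 0 \<noteq> refl_subgroup ?i"
    by (simp add: refl_subgroup_eq_iff)
  \<comment> \<open>The rotations b (a^m b) = a^(-m) and (a^m b) b = a^m agree because n = 2m; the
    other products match anyway.\<close>
  have "x (- ?i) False = x ?i False"
    by (simp add: x_eq_iff m cong_iff_dvd_diff flip: mult_2)
  then have "refl_subgroup 0 <#> refl_subgroup ?i = refl_subgroup ?i <#> refl_subgroup 0"
    by (auto simp: refl_subgroup_def set_mult_def mult)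
  then show ?thesis
    using ne refl_subgroup_vertex unfolding Gamma_N_edges_def by blast
qed

lemma edge_if_odd_divisor:
  assumes "odd n" "d dvd n" "d \<noteq> 1" "d \<noteq> n"
  shows "Gamma_N_edges G \<noteq> {}"
proof -
  define K where "K = {x (int d * j) e | j e. True}"
  have d_dvd: "int d dvd int n"
    using assms by simp
  \<comment> \<open>As d divides n, divisibility by d depends only on the residue modulo n, so any
    representative decides membership.\<close>
  have mem_K: "x i e \<in> K \<longleftrightarrow> int d dvd i" for i e
  proof
    assume "x i e \<in> K"
    then obtain j where "[i = int d * j] (mod int n)"
      by (auto simp: K_def x_eq_iff)
    then have "[i = int d * j] (mod int d)"
      using d_dvd by (rule cong_dvd_modulus)
    then show "int d dvd i"
      by (simp add: cong_dvd_iff)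
  qed (auto simp: K_def dvd_def)
  have sub: "subgroup K G"
  proof (rule subgroupI)
    show "K \<noteq> {}"
      by (auto simp: K_def)
    fix g assume "g \<in> K"
    then obtain j e where g: "g = x (int d * j) e"
      by (auto simp: K_def)
    show "inv g \<in> K"
      by (simp add: g inv_x mem_K)
    fix h assume "h \<in> K"
    then obtain k f where "h = x (int d * k) f"
      by (auto simp: K_def)
    then show "g \<otimes> h \<in> K"
      by (simp add: g mult mem_K)
  qed (auto simp: K_def)
  \<comment> \<open>The conjugate a^2 b of b lies in \<open>K\<close> only if d divides 2, which an
    odd d other than 1 does not. Hence \<open>K\<close> is neither normal nor the whole
    group.\<close>
  have "odd d"
    using assms dvd_trans by blast
  then have "\<not> d dvd 2"
    using assms by (metis dvd_refl prime_nat_iff two_is_prime_nat)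
  then have "\<not> int d dvd 2"
    using int_dvd_int_iff[of d 2] by simp
  then have "x 2 True \<notin> K"
    by (simp add: mem_K)
  moreover have "x 0 True \<in> K"
    by (simp add: mem_K)
  ultimately have "K \<in> Gamma_N_verts G"
    using sub normal_shift[of K 0] by (force simp: Gamma_N_verts_def)
  moreover have "refl_subgroup 0 \<noteq> K"
  proof
    assume "refl_subgroup 0 = K"
    moreover have "x (int d) False \<in> K"
      by (simp add: mem_K)
    ultimately have "int n dvd int d"
      by (auto simp: refl_subgroup_def x_eq_iff cong_0_iff)
    then show False
      using assms dvd_antisym by auto
  qed
  \<comment> \<open>A subgroup absorbs any subgroup inside it from both sides, so both products are
    \<open>K\<close>.\<close>
  moreover have "refl_subgroup 0 <#> K = K <#> refl_subgroup 0"
  proof -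
    have "refl_subgroup 0 \<subseteq> K"
      by (simp add: refl_subgroup_def mem_K)
    then have "K <#> refl_subgroup 0 = K"
      using set_mult_subgroup_idem[OF sub] subgroup_incl[OF subgroup_refl_subgroup sub] by blast
    moreover have "refl_subgroup 0 <#> K = K"
    proof
      show "refl_subgroup 0 <#> K \<subseteq> K"
        using \<open>refl_subgroup 0 \<subseteq> K\<close> subgroup.m_closed[OF sub] by (auto simp: set_mult_def)
      show "K \<subseteq> refl_subgroup 0 <#> K"
        using subgroup.mem_carrier[OF sub]
        by (force simp: set_mult_def refl_subgroup_def simp flip: one_eq)
    qed
    ultimately show ?thesis
      by simp
  qed
  ultimately show ?thesis
    using refl_subgroup_vertex unfolding Gamma_N_edges_def by blast
qed

section \<open>No edges for odd primes\<close>

lemma nonnormal_subgroup_if_prime: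
  assumes "prime n" "H \<in> Gamma_N_verts G"
  obtains i where "H = refl_subgroup i"
proof -
  have sub: "subgroup H G" and proper: "H \<noteq> carrier G" and nonnormal: "\<not> H \<lhd> G"
    using assms(2) by (auto simp: Gamma_N_verts_def)
  have H_subset: "H \<subseteq> carrier G"
    using sub by (rule subgroup.subset)
  have zero: "x 0 False \<in> H"
    using subgroup.one_closed[OF sub] by (simp add: one_eq)
  have no_rotation: "[k = 0] (mod int n)" if k: "x k False \<in> H" for k
  proof (rule ccontr)
    assume "\<not> [k = 0] (mod int n)"
    then have "coprime k (int n)"
      using assms(1) prime_imp_coprime[of "int n" k] by (simp add: cong_0_iff coprime_commute)
    then obtain u where "[k * u = 1] (mod int n)"
      using cong_solve_coprime_int by blast
    have multiple: "x (int t * k) False \<in> H" for t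
    proof (induction t)
      case (Suc t)
      then show ?case
        using subgroup_mult[OF sub k Suc] by (simp add: algebra_simps)
    qed (simp add: zero)
    have rotation: "x i False \<in> H" for i
    proof -
      obtain t where t: "[k * t = i] (mod int n)"
        using cong_scalar_right[OF \<open>[k * u = 1] (mod int n)\<close>, of i] that[of "u * i"]
        by (simp add: mult.assoc)
      \<comment> \<open>The integer t may be negative, while \<open>multiple\<close> covers natural
        multipliers only; its residue serves instead.\<close>
      have "x (int (nat (t mod int n)) * k) False = x i False"
        using t n_ge_3 by (simp add: x_eq_iff cong_def mod_mult_right_eq mult.commute)
      then show ?thesis
        using multiple by metis
    qed
    \<comment> \<open>With all rotations inside, \<open>H\<close> is the whole group if it has a
      reflection, and otherwise the normal subgroup of rotations.\<close>
    show False
    proof (cases "\<exists>j. x j True \<in> H")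
      case True
      then obtain j where j: "x j True \<in> H"
        by blast
      have "x i e \<in> H" for i e
        using rotation subgroup_mult[OF sub rotation[of "i - j"] j] by (cases e) auto
      then show False
        using proper H_subset by (auto simp: carrier_eq)
    next
      case False
      then have "H \<lhd> G"
        using rotation by (auto simp: normal_iff[OF sub] mult inv_x)
      then show False
        using nonnormal by contradiction
    qed
  qed
  \<comment> \<open>Without reflections \<open>H\<close> would be trivial, hence normal.\<close>
  obtain i where i: "x i True \<in> H"
  proof (rule ccontr)
    assume "\<not> thesis"
    with that have no_reflection: "x j True \<notin> H" for j
      by blast
    have "H \<lhd> G"
      unfolding normal_iff[OF sub]
    proof (intro allI impI)
      fix i e j f assume jf: "x j f \<in> H"
      then have "\<not> f"
        using no_reflection by (cases f) auto
      then have "x j f = \<one>"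
        using jf no_rotation by (simp add: one_eq x_eq_iff)
      then show "x i e \<otimes> x j f \<otimes> inv (x i e) \<in> H"
        using zero by (simp flip: one_eq)
    qed
    then show False
      using nonnormal by contradiction
  qed
  have "h \<in> refl_subgroup i" if h: "h \<in> H" for h
  proof -
    obtain j e where je: "h = x j e"
      using h H_subset by (auto simp: carrier_eq)
    show ?thesis
    proof (cases e)
      case True
      \<comment> \<open>The product of the reflections a^j b and a^i b is the rotation a^(j-i),
        which must be trivial.\<close>
      then have "[j - i = 0] (mod int n)"
        using subgroup_mult[OF sub h[unfolded je] i] no_rotation by simp
      then show ?thesis
        using True by (simp add: je refl_subgroup_def x_eq_iff cong_diff_iff_cong_0)
    next
      case False
      then show ?thesis
        using h no_rotation by (simp add: je refl_subgroup_def x_eq_iff)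
    qed
  qed
  then have "H = refl_subgroup i"
    using zero i by (auto simp: refl_subgroup_def)
  then show thesis
    by (rule that)
qed

lemma refl_subgroup_eq_if_permutable:
  assumes "odd n" "refl_subgroup i <#> refl_subgroup j = refl_subgroup j <#> refl_subgroup i"
  shows "refl_subgroup i = refl_subgroup j"
proof -
  \<comment> \<open>This is (a^i b)(a^j b). The only rotations in the reversed product are 1 and
    a^(j-i), so n divides 2(i-j) in either case, and odd n allows cancelling 2.\<close>
  have "x (i - j) False \<in> refl_subgroup i <#> refl_subgroup j"
    by (auto simp: refl_subgroup_def set_mult_def mult)
  also note assms(2)
  finally have "[i - j = 0] (mod int n) \<or> [i - j = j - i] (mod int n)"
    by (auto simp: refl_subgroup_def set_mult_def mult x_eq_iff)
  then have "int n dvd 2 * (i - j)"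
    by (auto simp: cong_iff_dvd_diff algebra_simps)
  moreover have "coprime (int n) 2"
    using assms(1) by simp
  ultimately show ?thesis
    by (simp only: refl_subgroup_eq_iff cong_iff_dvd_diff coprime_dvd_mult_right_iff)
qed

theorem Gamma_N_edges_empty_iff: "Gamma_N_edges G = {} \<longleftrightarrow> prime n \<and> odd n"
proof
  assume empty: "Gamma_N_edges G = {}"
  then have "odd n"
    using edge_if_even by blast
  moreover have "prime n"
    using empty edge_if_odd_divisor[OF \<open>odd n\<close>] n_ge_3 by (auto simp: prime_nat_iff)
  ultimately show "prime n \<and> odd n"
    by simp
next
  assume "prime n \<and> odd n"
  then have "H = K" if "H \<in> Gamma_N_verts G" "K \<in> Gamma_N_verts G" "H <#> K = K <#> H" for H K
    using that refl_subgroup_eq_if_permutable nonnormal_subgroup_if_prime by metis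
  then show "Gamma_N_edges G = {}"
    unfolding Gamma_N_edges_def by blast
qed

end

section \<open>An action that separates words\<close>

text \<open>The action on the integers modulo \<open>n\<close>, lifted to integer representatives.\<close>

fun letter_act :: "dihedral_gen \<times> bool \<Rightarrow> int \<Rightarrow> int" where
  "letter_act (Gen_a, s) t = (if s then t + 1 else t - 1)"
| "letter_act (Gen_b, s) t = - t"

definition act :: "dihedral_gen word \<Rightarrow> int \<Rightarrow> int" where
  "act w = foldr letter_act w"

lemma act_simps [simp]:
  "act [] t = t" "act (l # w) t = letter_act l (act w t)" "act (u @ v) t = act u (act v t)"
  by (simp_all add: act_def)

lemma act_replicate_a: "act (replicate k (Gen_a, True)) t = t + int k"
  by (induction k) auto

text \<open>On integer representatives a^n acts as adding n, not as the identity; the resulting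
  congruence has to survive a prefix word.\<close>

lemma act_cong: "[s = t] (mod m) \<Longrightarrow> [act w s = act w t] (mod m)"
proof (induction w)
  case (Cons l w)
  then show ?case
    by (cases l; cases "fst l")
       (auto intro: cong_add cong_diff simp: cong_minus_minus_iff)
qed simp

lemma mem_dihedral_relations_iff:
  "(l, r) \<in> dihedral_relations n \<longleftrightarrow>
    l = replicate n (Gen_a, True) \<and> r = [] \<or>
    l = [(Gen_b, True), (Gen_b, True)] \<and> r = [] \<or>
    l = [(Gen_a, True), (Gen_b, True)] \<and> r = [(Gen_b, True), (Gen_a, False)]"
  by (auto simp: dihedral_relations_def Let_def numeral_2_eq_2)

text \<open>Soundness of the action: words that act differently modulo n represent different group
  elements.\<close>

lemma pres_eq_imp_act_cong:
  "pres_eq (dihedral_relations n) u v \<Longrightarrow> [act u t = act v t] (mod int n)"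
proof (induction arbitrary: t rule: pres_eq.induct)
  case (sym u v)
  then show ?case
    by (simp add: cong_sym)
next
  case (trans u v w)
  then show ?case
    by (blast intro: cong_trans)
next
  case (cancel u y e v)
  then show ?case
    by (cases y) auto
next
  case (rel l r u v)
  then have "[act l s = act r s] (mod int n)" for s
    by (auto simp: mem_dihedral_relations_iff act_replicate_a cong_def)
  then show ?case
    by (simp add: act_cong)
qed simp

section \<open>Normal forms in the presented group\<close>

lemma pres_class_eqI:
  "pres_eq R u v \<Longrightarrow> pres_class R u = pres_class R v"
  by (blast intro: pres_eq.trans pres_eq.sym)

text \<open>Reducing i modulo n turns any integer exponent into a natural one, as a word without
  inverse letters requires.\<close>

definition dihedral_elem :: "nat \<Rightarrow> int \<Rightarrow> bool \<Rightarrow> dihedral_gen word set" where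
  "dihedral_elem n i e =
    pres_class (dihedral_relations n)
      (replicate (nat (i mod int n)) (Gen_a, True) @ (if e then [(Gen_b, True)] else []))"

context
  fixes n :: nat and A B
  assumes n: "n > 0"
  defines "A \<equiv> pres_class (dihedral_relations n) [(Gen_a, True)]"
    and "B \<equiv> pres_class (dihedral_relations n) [(Gen_b, True)]"
begin

interpretation G: group "dihedral_group n"
  unfolding dihedral_group_def by (rule group_presented_group)

private abbreviation (input) D where "D \<equiv> dihedral_group n"

lemma mult_class:
  "pres_class (dihedral_relations n) u \<otimes>\<^bsub>D\<^esub> pres_class (dihedral_relations n) v =
    pres_class (dihedral_relations n) (u @ v)"
  by (simp add: dihedral_group_def mult_presented_group)

lemma one_class: "\<one>\<^bsub>D\<^esub> = pres_class (dihedral_relations n) []"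
  by (simp add: dihedral_group_def one_presented_group)

lemma class_closed: "pres_class (dihedral_relations n) u \<in> carrier D"
  by (simp add: dihedral_group_def carrier_presented_group)

lemma A_closed [simp]: "A \<in> carrier D" and B_closed [simp]: "B \<in> carrier D"
  unfolding A_def B_def by (rule class_closed)+

lemma class_eq_if_related:
  "(l, r) \<in> dihedral_relations n \<Longrightarrow>
    pres_class (dihedral_relations n) l = pres_class (dihedral_relations n) r"
  using pres_eq.rel[of l r "dihedral_relations n" "[]" "[]"] by (intro pres_class_eqI) simp

lemma class_inverse_letter:
  "pres_class (dihedral_relations n) [(y, False)] = inv\<^bsub>D\<^esub> pres_class (dihedral_relations n) [(y, True)]"
  using pres_class_eqI[OF pres_eq.cancel[of "dihedral_relations n" "[]" y False "[]"]]
  by (intro G.inv_equality[symmetric] class_closed) (simp_all add: mult_class one_class)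

lemma class_replicate: "pres_class (dihedral_relations n) (replicate k (Gen_a, True)) = A [^]\<^bsub>D\<^esub> k"
proof (induction k)
  case (Suc k)
  then show ?case
    using mult_class[of "replicate k (Gen_a, True)" "[(Gen_a, True)]"]
    by (simp add: A_def replicate_append_same)
qed (simp add: one_class)

lemma A_pow_n: "A [^]\<^bsub>D\<^esub> n = \<one>\<^bsub>D\<^esub>"
  using class_eq_if_related[of "replicate n (Gen_a, True)" "[]"]
  by (simp add: mem_dihedral_relations_iff class_replicate one_class)

lemma B_B: "B \<otimes>\<^bsub>D\<^esub> B = \<one>\<^bsub>D\<^esub>"
  using class_eq_if_related[of "[(Gen_b, True), (Gen_b, True)]" "[]"]
  by (simp add: mem_dihedral_relations_iff B_def mult_class one_class)

lemma A_B: "A \<otimes>\<^bsub>D\<^esub> B = B \<otimes>\<^bsub>D\<^esub> inv\<^bsub>D\<^esub> A"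
  using class_eq_if_related[of "[(Gen_a, True), (Gen_b, True)]" "[(Gen_b, True), (Gen_a, False)]"]
  by (simp add: mem_dihedral_relations_iff A_def B_def mult_class flip: class_inverse_letter)

lemma A_int_pow_mod: "A [^]\<^bsub>D\<^esub> (i mod int n) = A [^]\<^bsub>D\<^esub> i"
proof -
  have "A [^]\<^bsub>D\<^esub> i = A [^]\<^bsub>D\<^esub> (int n * (i div int n) + i mod int n)"
    by simp
  also have "\<dots> = (A [^]\<^bsub>D\<^esub> int n) [^]\<^bsub>D\<^esub> (i div int n) \<otimes>\<^bsub>D\<^esub> A [^]\<^bsub>D\<^esub> (i mod int n)"
    by (simp only: G.int_pow_mult G.int_pow_pow A_closed)
  finally show ?thesis
    by (simp add: int_pow_int A_pow_n)
qed

lemma dihedral_elem_eq: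
  "dihedral_elem n i e = A [^]\<^bsub>D\<^esub> i \<otimes>\<^bsub>D\<^esub> (if e then B else \<one>\<^bsub>D\<^esub>)"
proof -
  have "A [^]\<^bsub>D\<^esub> nat (i mod int n) = A [^]\<^bsub>D\<^esub> i"
    using n by (simp add: A_int_pow_mod flip: int_pow_int)
  then show ?thesis
    by (simp add: dihedral_elem_def B_def one_class class_replicate flip: mult_class)
qed

text \<open>The induction uses the inverse-free form A^k B A^k = B, whose case k = 1 is the relation
  \<open>A_B\<close>. Integer exponents reduce to natural ones modulo n.\<close>

lemma B_A_pow: "B \<otimes>\<^bsub>D\<^esub> A [^]\<^bsub>D\<^esub> i = A [^]\<^bsub>D\<^esub> (- i) \<otimes>\<^bsub>D\<^esub> B" for i :: int
proof -
  have ABA: "A \<otimes>\<^bsub>D\<^esub> (B \<otimes>\<^bsub>D\<^esub> A) = B"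
    by (simp add: A_B G.m_assoc flip: G.m_assoc[of A B A])
  have "A [^]\<^bsub>D\<^esub> k \<otimes>\<^bsub>D\<^esub> (B \<otimes>\<^bsub>D\<^esub> A [^]\<^bsub>D\<^esub> k) = B" for k :: nat
  proof (induction k)
    case (Suc k)
    have "A [^]\<^bsub>D\<^esub> k \<otimes>\<^bsub>D\<^esub> A \<otimes>\<^bsub>D\<^esub> (B \<otimes>\<^bsub>D\<^esub> (A \<otimes>\<^bsub>D\<^esub> A [^]\<^bsub>D\<^esub> k)) =
        A [^]\<^bsub>D\<^esub> k \<otimes>\<^bsub>D\<^esub> (A \<otimes>\<^bsub>D\<^esub> (B \<otimes>\<^bsub>D\<^esub> A) \<otimes>\<^bsub>D\<^esub> A [^]\<^bsub>D\<^esub> k)"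
      by (simp add: G.m_assoc)
    moreover have "A \<otimes>\<^bsub>D\<^esub> A [^]\<^bsub>D\<^esub> k = A [^]\<^bsub>D\<^esub> k \<otimes>\<^bsub>D\<^esub> A"
      using G.nat_pow_Suc2[of A k] by simp
    ultimately have "A [^]\<^bsub>D\<^esub> Suc k \<otimes>\<^bsub>D\<^esub> (B \<otimes>\<^bsub>D\<^esub> A [^]\<^bsub>D\<^esub> Suc k) =
        A [^]\<^bsub>D\<^esub> k \<otimes>\<^bsub>D\<^esub> (A \<otimes>\<^bsub>D\<^esub> (B \<otimes>\<^bsub>D\<^esub> A) \<otimes>\<^bsub>D\<^esub> A [^]\<^bsub>D\<^esub> k)"
      by simp
    then show ?case
      using Suc by (simp add: ABA)
  qed simp
  from this[of "nat (i mod int n)"] have "A [^]\<^bsub>D\<^esub> i \<otimes>\<^bsub>D\<^esub> (B \<otimes>\<^bsub>D\<^esub> A [^]\<^bsub>D\<^esub> i) = B"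
    using n by (simp add: A_int_pow_mod flip: int_pow_int)
  then show ?thesis
    using G.inv_solve_left[of "B \<otimes>\<^bsub>D\<^esub> A [^]\<^bsub>D\<^esub> i" "A [^]\<^bsub>D\<^esub> i" B] by (simp add: G.int_pow_neg)
qed

lemma dihedral_elem_mult:
  "dihedral_elem n i e \<otimes>\<^bsub>D\<^esub> dihedral_elem n j f =
    dihedral_elem n (i + (if e then - j else j)) (e \<noteq> f)"
proof (cases e)
  case True
  \<comment> \<open>Here \<open>Y\<close> stands for \<open>B\<close> or the identity, covering both
    values of \<open>f\<close>.\<close>
  have "A [^]\<^bsub>D\<^esub> i \<otimes>\<^bsub>D\<^esub> B \<otimes>\<^bsub>D\<^esub> (A [^]\<^bsub>D\<^esub> j \<otimes>\<^bsub>D\<^esub> Y) =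
    A [^]\<^bsub>D\<^esub> (i - j) \<otimes>\<^bsub>D\<^esub> (B \<otimes>\<^bsub>D\<^esub> Y)" if "Y \<in> carrier D" for Y
  proof -
    have "A [^]\<^bsub>D\<^esub> i \<otimes>\<^bsub>D\<^esub> B \<otimes>\<^bsub>D\<^esub> (A [^]\<^bsub>D\<^esub> j \<otimes>\<^bsub>D\<^esub> Y) =
      A [^]\<^bsub>D\<^esub> i \<otimes>\<^bsub>D\<^esub> (B \<otimes>\<^bsub>D\<^esub> A [^]\<^bsub>D\<^esub> j) \<otimes>\<^bsub>D\<^esub> Y"
      using that by (simp add: G.m_assoc)
    also have "\<dots> = A [^]\<^bsub>D\<^esub> i \<otimes>\<^bsub>D\<^esub> A [^]\<^bsub>D\<^esub> (- j) \<otimes>\<^bsub>D\<^esub> (B \<otimes>\<^bsub>D\<^esub> Y)"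
      using that unfolding B_A_pow by (simp add: G.m_assoc)
    finally show ?thesis
      using G.int_pow_mult[of A i "- j"] by simp
  qed
  then show ?thesis
    using True by (simp add: dihedral_elem_eq B_B)
next
  case False
  then show ?thesis
    by (simp add: dihedral_elem_eq G.int_pow_mult G.m_assoc)
qed

lemma carrier_dihedral_group: "carrier D = {dihedral_elem n i e | i e. True}"
proof
  \<comment> \<open>Single letters are normal forms, because b is its own inverse, and normal forms
    are closed under products.\<close>
  have "\<exists>i e. pres_class (dihedral_relations n) w = dihedral_elem n i e" for w
  proof (induction w)
    case Nil
    show ?case
      by (rule exI[of _ 0], rule exI[of _ False]) (simp add: dihedral_elem_def)
  next
    case (Cons l w)
    have "\<exists>i e. pres_class (dihedral_relations n) [l] = dihedral_elem n i e"
    proof (cases l)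
      case (Pair y s)
      have inv_B: "inv\<^bsub>D\<^esub> B = B"
        by (simp add: G.inv_equality B_B)
      have "A = dihedral_elem n 1 False" "inv\<^bsub>D\<^esub> A = dihedral_elem n (- 1) False"
        "B = dihedral_elem n 0 True"
        by (simp_all add: dihedral_elem_eq G.int_pow_neg G.int_pow_1)
      then show ?thesis
        unfolding Pair
        using class_inverse_letter[of y] inv_B by (cases y; cases s) (auto simp: A_def B_def)
    qed
    then show ?case
      using Cons mult_class[of "[l]" w] dihedral_elem_mult by (metis append_Cons append_Nil)
  qed
  then show "carrier D \<subseteq> {dihedral_elem n i e | i e. True}"
    by (auto simp: dihedral_group_def carrier_presented_group)
  show "{dihedral_elem n i e | i e. True} \<subseteq> carrier D"
    using class_closed by (auto simp: dihedral_elem_def)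
qed

end

lemma dihedral_elem_eq_iff:
  assumes "n \<ge> 3"
  shows "dihedral_elem n i e = dihedral_elem n j f \<longleftrightarrow> [i = j] (mod int n) \<and> e = f"
proof
  assume eq: "dihedral_elem n i e = dihedral_elem n j f"
  have act_elem: "[act (replicate (nat (i mod int n)) (Gen_a, True) @
      (if e then [(Gen_b, True)] else [])) t = i + (if e then - t else t)] (mod int n)" for i e t
    using assms by (auto simp: act_replicate_a cong_def mod_simps add.commute)
  have "pres_eq (dihedral_relations n)
      (replicate (nat (i mod int n)) (Gen_a, True) @ (if e then [(Gen_b, True)] else []))
      (replicate (nat (j mod int n)) (Gen_a, True) @ (if f then [(Gen_b, True)] else []))"
    using eq pres_eq.refl unfolding dihedral_elem_def by blast
  then have act_eq: "[i + (if e then - t else t) = j + (if f then - t else t)] (mod int n)" for t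
    using act_elem pres_eq_imp_act_cong by (meson cong_sym cong_trans)
  \<comment> \<open>Acting on 0 recovers the exponent of a; acting on 1 then detects b, since a
    mismatch would make n divide 2.\<close>
  have ij: "[i = j] (mod int n)"
    using act_eq[of 0] by (cases e; cases f) simp_all
  moreover have "e = f"
  proof (rule ccontr)
    assume "e \<noteq> f"
    with act_eq[of 1] have "int n dvd (i - j) + 2 \<or> int n dvd (i - j) - 2"
      by (cases e; cases f) (auto simp: cong_iff_dvd_diff algebra_simps)
    with ij have "int n dvd 2"
      by (auto simp: cong_iff_dvd_diff dvd_add_right_iff dvd_diff_right_iff)
    then show False
      using assms zdvd_imp_le by fastforce
  qed
  ultimately show "[i = j] (mod int n) \<and> e = f"
    by simp
qed (simp add: dihedral_elem_def cong_def)

lemma dihedral_dihedral_group: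
  assumes "n \<ge> 3"
  shows "dihedral (dihedral_group n) n (dihedral_elem n)"
proof -
  interpret group "dihedral_group n"
    unfolding dihedral_group_def by (rule group_presented_group)
  show ?thesis
    using assms by unfold_locales
      (auto simp: carrier_dihedral_group dihedral_elem_mult dihedral_elem_eq_iff)
qed

theorem theorem4p3:
  fixes n :: nat
  assumes "n \<ge> 3"
  shows "totally_disconnected (Gamma_N (dihedral_group n)) \<longleftrightarrow> prime n \<and> odd n"
proof -
  interpret dihedral "dihedral_group n" n "dihedral_elem n"
    using assms by (rule dihedral_dihedral_group)
  show ?thesis
    using Gamma_N_edges_empty_iff by (simp add: totally_disconnected_def Gamma_N_def)
qed

end
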